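(* Let $Q$ be a finite abelian group of order $q$ which is also a commutative ring with unity and has a generating character, and let $G=(V,E)$ be a finite graph with a fixed orientation and coboundary $\delta$. Let $(s_a)_{a\in Q}$ and $(t_b)_{b\in Q}$ be complex numbers with $t_{-b}=t_b$ for all $b\in Q$, and let $(u_b)_{b\in Q}$ be complex numbers with $t_b=\sum_{a\in Q}u_au_{a-b}$ for all $b\in Q$. Then $$X_Q(G;(s_a),(t_b))=\sum_{y\in Q^E}\prod_{v\in V}\sum_{a\in Q}s_a\prod_{b\in Q}u_b^{\#\{e\ni v:\,y_e=a+b\}}.$$ In particular, for $q\geq 2$ and indeterminates $s,t$, $$(t^2-1)^{|E|}X_q\Big(G;1,s,\ldots,s^{q-1};\frac{t^2-1+q}{t^2-1}\Big)=q^{-|E|}(t-1)^{2|E|}\sum_{y\in\{0,1,\ldots,q-1\}^E}\prod_{v\in V}\sum_{a=0}^{q-1}s^a\Big(\frac{t-1+q}{t-1}\Big)^{\#\{e\ni v:\,y_e=a\}}.$$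
   Context: $(\delta x)_e=\sum_v\sigma_{v,e}x_v$ where $\sigma_{v,e}=+1$ if $e$ is directed into $v$, $-1$ if out of $v$, $0$ if $v\notin e$. Define $X_Q(G;(s_a)_{a\in Q},(t_b)_{b\in Q})=\sum_{x\in Q^V}\prod_{a\in Q}s_a^{\#\{v:x_v=a\}}\prod_{b\in Q}t_b^{\#\{e:(\delta x)_e=b\}}$, and $X_q(G;s_0,\ldots,s_{q-1};t)=\sum_{x\in\{0,\ldots,q-1\}^V}t^{\#\{uv\in E:x_u=x_v\}}\prod_{a=0}^{q-1}s_a^{\#\{v:x_v=a\}}$. Graphs may have loops and multiple edges; $\#\{e\ni v:y_e=c\}$ counts half-edges at $v$ (a loop at $v$ counts twice) whose edge has colour $c$. *)

theory Defs
  imports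
    Complex_Main
    "HOL-Library.FuncSet"
    "HOL-Algebra.Ring"
    "HOL-Computational_Algebra.Polynomial"
    "HOL-Computational_Algebra.Fraction_Field"
    "Graph_Theory.Digraph"
begin

text \<open>
  A finite graph with a fixed orientation is an arbitrary finite digraph
  (\<^locale>\<open>fin_digraph\<close>, loops and parallel arcs allowed); vertex and edge colourings are
  extensional functions on \<open>verts G\<close> and \<open>arcs G\<close>.
  The ring \<open>Q\<close> is a \<^locale>\<open>cring\<close> and not an instance of \<open>comm_ring_1\<close>, so that the trivial
  ring of order 1 is included.
\<close>

text \<open>Characters of the additive group, i.e. homomorphisms into the nonzero complex numbers.
  Values outside the carrier are irrelevant.\<close>

definition additive_character :: "('r, 'm) ring_scheme \<Rightarrow> ('r \<Rightarrow> complex) \<Rightarrow> bool" where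
  "additive_character Q \<chi> \<longleftrightarrow>
     (\<forall>a\<in>carrier Q. \<chi> a \<noteq> 0) \<and>
     (\<forall>a\<in>carrier Q. \<forall>b\<in>carrier Q. \<chi> (a \<oplus>\<^bsub>Q\<^esub> b) = \<chi> a * \<chi> b)"

definition generating_character :: "('r, 'm) ring_scheme \<Rightarrow> ('r \<Rightarrow> complex) \<Rightarrow> bool" where
  "generating_character Q \<chi> \<longleftrightarrow>
     additive_character Q \<chi> \<and>
     (\<forall>\<psi>. additive_character Q \<psi> \<longrightarrow>
        (\<exists>a\<in>carrier Q. \<forall>b\<in>carrier Q. \<psi> b = \<chi> (a \<otimes>\<^bsub>Q\<^esub> b)))"

text \<open>A loop is directed both into and out of its vertex, and the two contributions cancel.\<close>

definition incidence_sign :: "('v, 'e) pre_digraph \<Rightarrow> 'v \<Rightarrow> 'e \<Rightarrow> int" where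
  "incidence_sign G v e = of_bool (head G e = v) - of_bool (tail G e = v)"

definition coboundary ::
    "('r, 'm) ring_scheme \<Rightarrow> ('v, 'e) pre_digraph \<Rightarrow> ('v \<Rightarrow> 'r) \<Rightarrow> 'e \<Rightarrow> 'r" where
  "coboundary Q G x e = (\<Oplus>\<^bsub>Q\<^esub>v\<in>verts G. [incidence_sign G v e] \<cdot>\<^bsub>Q\<^esub> x v)"

lemma (in cring) coboundary_eq_head_minus_tail:
  assumes "fin_digraph G" "e \<in> arcs G" "x \<in> verts G \<rightarrow> carrier R"
  shows "coboundary R G x e = x (head G e) \<ominus> x (tail G e)"
proof -
  interpret G: fin_digraph G by fact
  let ?h = "head G e" and ?t = "tail G e"
  have h: "?h \<in> verts G" and t: "?t \<in> verts G"
    using assms(2) by auto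
  have x: "x v \<in> carrier R" if "v \<in> verts G" for v
    using assms(3) that by blast
  have "coboundary R G x e =
      (\<Oplus>v\<in>verts G. (if ?h = v then x v else \<zero>) \<oplus> (if ?t = v then \<ominus> x v else \<zero>))"
    unfolding coboundary_def
  proof (rule add.finprod_cong')
    show "[incidence_sign G v e] \<cdot> x v =
        (if ?h = v then x v else \<zero>) \<oplus> (if ?t = v then \<ominus> x v else \<zero>)"
      if "v \<in> verts G" for v
      using x[OF that] add.int_pow_neg[of "x v" 1] add.int_pow_1[of "x v"]
      by (auto simp: incidence_sign_def r_neg add_pow_def)
  qed (use x in auto)
  also have "\<dots> = (\<Oplus>v\<in>verts G. if ?h = v then x v else \<zero>) \<oplus>
      (\<Oplus>v\<in>verts G. if ?t = v then \<ominus> x v else \<zero>)"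
    by (rule add.finprod_multf) (use x in auto)
  also have "\<dots> = x ?h \<oplus> \<ominus> x ?t"
    using add.finprod_singleton[OF h, of x] add.finprod_singleton[OF t, of "\<lambda>v. \<ominus> x v"] x by auto
  finally show ?thesis
    by (simp add: minus_eq)
qed

definition ring_partition_function ::
    "('r, 'm) ring_scheme \<Rightarrow> ('v, 'e) pre_digraph \<Rightarrow> ('r \<Rightarrow> 'c) \<Rightarrow> ('r \<Rightarrow> 'c) \<Rightarrow>
      'c::comm_semiring_1" where
  "ring_partition_function Q G s t =
     (\<Sum>x \<in> verts G \<rightarrow>\<^sub>E carrier Q.
        (\<Prod>a\<in>carrier Q. s a ^ card {v \<in> verts G. x v = a}) *
        (\<Prod>b\<in>carrier Q. t b ^ card {e \<in> arcs G. coboundary Q G x e = b}))"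

definition potts_partition_function ::
    "nat \<Rightarrow> ('v, 'e) pre_digraph \<Rightarrow> (nat \<Rightarrow> 'c) \<Rightarrow> 'c \<Rightarrow> 'c::comm_semiring_1" where
  "potts_partition_function q G s t =
     (\<Sum>x \<in> verts G \<rightarrow>\<^sub>E {0..<q}.
        t ^ card {e \<in> arcs G. x (tail G e) = x (head G e)} *
        (\<Prod>a = 0..<q. s a ^ card {v \<in> verts G. x v = a}))"

text \<open>The number of half-edges at \<open>v\<close> whose edge has colour \<open>c\<close>: a loop at \<open>v\<close> lies both in
  \<open>out_arcs G v\<close> and in \<open>in_arcs G v\<close> and is counted twice.\<close>

definition half_edge_count ::
    "('v, 'e) pre_digraph \<Rightarrow> ('e \<Rightarrow> 'c) \<Rightarrow> 'v \<Rightarrow> 'c \<Rightarrow> nat" where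
  "half_edge_count G y v c =
     card {e \<in> out_arcs G v. y e = c} + card {e \<in> in_arcs G v. y e = c}"

text \<open>The two generators of the field of rational functions \<open>\<complex>(s, t)\<close>, as fractions of
  polynomials in \<open>t\<close> over \<open>\<complex>[s]\<close>.\<close>

definition indet_s :: "complex poly poly fract" where
  "indet_s = Fract [:[:0, 1:]:] 1"

definition indet_t :: "complex poly poly fract" where
  "indet_t = Fract [:0, 1:] 1"

end

theory Submission
  imports Defs
begin

text \<open>
  Expanding the product over the vertices on the right-hand side gives a sum over vertex
  colourings \<open>x\<close> and edge colourings \<open>y\<close>.  After exchanging the two sums, the half-edge factors can be
  regrouped by edges, and the sum over \<open>y\<close> then splits into one independent sum over
  the colours of each edge, namely an edge interaction of \<open>x\<close>.  Over \<open>Q\<close>, that interaction is the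
  self-correlation \<open>t\<close> of \<open>u\<close>.  For the Potts model with \<open>w = (t - 1 + q) / (t - 1)\<close>, it
  is \<open>w\<^sup>2 + (q - 1)\<close> on equal and \<open>2 w + (q - 2)\<close> on different end colours.
\<close>

text \<open>The fibres of \<open>g\<close> over \<open>T\<close> partition \<open>S\<close>. This is
  the bridge between weights whose exponents count colours, as in both partition functions, and
  products taken over vertices or arcs one at a time.\<close>

lemma prod_power_card_fibre:
  fixes f :: "'b \<Rightarrow> 'c::comm_monoid_mult"
  assumes "finite S" "finite T" "g ` S \<subseteq> T"
  shows "(\<Prod>d\<in>T. f d ^ card {x \<in> S. g x = d}) = (\<Prod>x\<in>S. f (g x))"
proof -
  have "(\<Prod>d\<in>T. f d ^ card {x \<in> S. g x = d}) = (\<Prod>d\<in>T. \<Prod>x\<in>{x \<in> S. g x = d}. f (g x))"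
    by simp
  also have "\<dots> = (\<Prod>x\<in>S. f (g x))"
    using assms by (rule prod.group)
  finally show ?thesis .
qed

context fin_digraph
begin

text \<open>Every arc has one half-edge at its tail and one at its head, so collecting the
  half-edges by arc instead of by vertex leaves two factors per arc. A loop supplies both factors at
  the same vertex, in agreement with its being counted twice.\<close>

lemma prod_half_edge_count:
  fixes w :: "'c \<Rightarrow> 'd \<Rightarrow> 'k::comm_monoid_mult"
  assumes "finite D" "y \<in> arcs G \<rightarrow> D"
  shows "(\<Prod>v\<in>verts G. \<Prod>d\<in>D. w (x v) d ^ half_edge_count G y v d) =
    (\<Prod>e\<in>arcs G. w (x (tail G e)) (y e) * w (x (head G e)) (y e))"
proof -
  \<comment> \<open>Here \<open>p\<close> stands for \<open>tail G\<close> or \<open>head G\<close>,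
    which covers the outgoing and the incoming half-edges at once.\<close>
  have fibre: "(\<Prod>d\<in>D. w (x v) d ^ card {e \<in> {e \<in> arcs G. p e = v}. y e = d}) =
      (\<Prod>e\<in>{e \<in> arcs G. p e = v}. w (x (p e)) (y e))" for p v
  proof -
    have "(\<Prod>d\<in>D. w (x v) d ^ card {e \<in> {e \<in> arcs G. p e = v}. y e = d}) =
        (\<Prod>e\<in>{e \<in> arcs G. p e = v}. w (x v) (y e))"
      using assms by (intro prod_power_card_fibre) auto
    also have "\<dots> = (\<Prod>e\<in>{e \<in> arcs G. p e = v}. w (x (p e)) (y e))"
      by (rule prod.cong) auto
    finally show ?thesis .
  qed
  have "(\<Prod>d\<in>D. w (x v) d ^ half_edge_count G y v d) =
      (\<Prod>e\<in>{e \<in> arcs G. tail G e = v}. w (x (tail G e)) (y e)) *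
      (\<Prod>e\<in>{e \<in> arcs G. head G e = v}. w (x (head G e)) (y e))" for v
    unfolding half_edge_count_def power_add prod.distrib out_arcs_def in_arcs_def fibre ..
  then show ?thesis
    by (simp only: prod.distrib, subst (1 2) prod.group) auto
qed

text \<open>The weight \<open>w a d\<close> of a half-edge may depend in any way on the vertex
  colour \<open>a\<close> and the edge colour \<open>d\<close>. Both parts of the theorem are
  instances: \<open>u (d \<ominus> a)\<close> over the ring, and a weight that singles out
  \<open>d = a\<close> for the Potts model.\<close>

lemma half_edge_expansion:
  fixes s :: "'c \<Rightarrow> 'k::comm_semiring_1"
  assumes "finite C" "finite D"
  shows "(\<Sum>y \<in> arcs G \<rightarrow>\<^sub>E D. \<Prod>v\<in>verts G. \<Sum>a\<in>C.
      s a * (\<Prod>d\<in>D. w a d ^ half_edge_count G y v d)) =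
    (\<Sum>x \<in> verts G \<rightarrow>\<^sub>E C. (\<Prod>v\<in>verts G. s (x v)) *
      (\<Prod>e\<in>arcs G. \<Sum>d\<in>D. w (x (tail G e)) d * w (x (head G e)) d))"
proof -
  have "(\<Sum>y \<in> arcs G \<rightarrow>\<^sub>E D. \<Prod>v\<in>verts G. \<Sum>a\<in>C.
      s a * (\<Prod>d\<in>D. w a d ^ half_edge_count G y v d)) =
    (\<Sum>y \<in> arcs G \<rightarrow>\<^sub>E D. \<Sum>x \<in> verts G \<rightarrow>\<^sub>E C. (\<Prod>v\<in>verts G. s (x v)) *
      (\<Prod>v\<in>verts G. \<Prod>d\<in>D. w (x v) d ^ half_edge_count G y v d))"
    using assms by (simp add: prod_sum_PiE prod.distrib)
  also have "\<dots> = (\<Sum>y \<in> arcs G \<rightarrow>\<^sub>E D. \<Sum>x \<in> verts G \<rightarrow>\<^sub>E C. (\<Prod>v\<in>verts G. s (x v)) *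
      (\<Prod>e\<in>arcs G. w (x (tail G e)) (y e) * w (x (head G e)) (y e)))"
    using assms by (intro sum.cong refl) (subst prod_half_edge_count; auto simp: PiE_def)
  \<comment> \<open>For fixed \<open>x\<close>, the factor of an arc \<open>e\<close> involves
    \<open>y\<close> only through \<open>y e\<close>, so the sum over \<open>y\<close>
    factorises.\<close>
  also have "\<dots> = (\<Sum>x \<in> verts G \<rightarrow>\<^sub>E C. (\<Prod>v\<in>verts G. s (x v)) *
      (\<Prod>e\<in>arcs G. \<Sum>d\<in>D. w (x (tail G e)) d * w (x (head G e)) d))"
    using assms by (subst sum.swap) (simp add: prod_sum_PiE sum_distrib_left)
  finally show ?thesis .
qed

end

lemma ring_partition_function_eq:
  fixes R (structure) and G :: "('v, 'e) pre_digraph" and s t u :: "'r \<Rightarrow> 'k::comm_semiring_1"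
  assumes "fin_digraph G" "cring R" and fin: "finite (carrier R)"
    and t: "\<And>b. b \<in> carrier R \<Longrightarrow> t b = (\<Sum>a\<in>carrier R. u a * u (a \<ominus> b))"
  shows "ring_partition_function R G s t =
    (\<Sum>y \<in> arcs G \<rightarrow>\<^sub>E carrier R. \<Prod>v\<in>verts G. \<Sum>a\<in>carrier R.
      s a * (\<Prod>b\<in>carrier R. u b ^ half_edge_count G y v (a \<oplus> b)))"
proof -
  interpret fin_digraph G by fact
  interpret R: cring R by fact
  have bij: "bij_betw (\<lambda>d. d \<ominus> a) (carrier R) (carrier R)" if "a \<in> carrier R" for a
    by (rule bij_betwI[where g = "\<lambda>b. b \<oplus> a"])
      (use that in \<open>auto simp: R.minus_eq R.a_assoc R.l_neg R.r_neg\<close>)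
  have shift: "a \<oplus> (d \<ominus> a) = d" if "a \<in> carrier R" "d \<in> carrier R" for a d
    using that R.a_lcomm[of a d "\<ominus> a"] by (simp add: R.minus_eq R.r_neg)
  \<comment> \<open>Substituting \<open>d = a \<oplus> b\<close> indexes the product by the edge
    colour itself and moves the vertex colour into the weight.\<close>
  have weight: "(\<Prod>b\<in>carrier R. u b ^ half_edge_count G y v (a \<oplus> b)) =
      (\<Prod>d\<in>carrier R. u (d \<ominus> a) ^ half_edge_count G y v d)" if "a \<in> carrier R" for y v a
    using that by (subst prod.reindex_bij_betw[OF bij[OF that], symmetric]) (simp add: shift)
  \<comment> \<open>Substituting \<open>a = d \<ominus> k\<close> in the correlation sum for
    \<open>t (h \<ominus> k)\<close>. With \<open>k\<close> the tail colour and \<open>h\<close> the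
    head colour, the argument of \<open>t\<close> is the value of the coboundary on the arc.\<close>
  have edge: "(\<Sum>d\<in>carrier R. u (d \<ominus> k) * u (d \<ominus> h)) = t (h \<ominus> k)"
    if "h \<in> carrier R" "k \<in> carrier R" for h k
  proof -
    have "(d \<ominus> k) \<ominus> (h \<ominus> k) = d \<ominus> h" if "d \<in> carrier R" for d
      using \<open>h \<in> carrier R\<close> \<open>k \<in> carrier R\<close> that
        R.a_lcomm[of "\<ominus> k" "\<ominus> h" k]
      by (simp add: R.minus_eq R.minus_add R.a_assoc R.l_neg)
    then show ?thesis
      using that by (subst t, simp, subst sum.reindex_bij_betw[OF bij[of k], symmetric]) auto
  qed
  have "(\<Sum>y \<in> arcs G \<rightarrow>\<^sub>E carrier R. \<Prod>v\<in>verts G. \<Sum>a\<in>carrier R.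
      s a * (\<Prod>b\<in>carrier R. u b ^ half_edge_count G y v (a \<oplus> b))) =
    (\<Sum>y \<in> arcs G \<rightarrow>\<^sub>E carrier R. \<Prod>v\<in>verts G. \<Sum>a\<in>carrier R.
      s a * (\<Prod>d\<in>carrier R. u (d \<ominus> a) ^ half_edge_count G y v d))"
    by (simp add: weight)
  also have "\<dots> = (\<Sum>x \<in> verts G \<rightarrow>\<^sub>E carrier R. (\<Prod>v\<in>verts G. s (x v)) *
      (\<Prod>e\<in>arcs G. \<Sum>d\<in>carrier R. u (d \<ominus> x (tail G e)) * u (d \<ominus> x (head G e))))"
    by (rule half_edge_expansion[OF fin fin])
  also have "\<dots> = ring_partition_function R G s t"
    unfolding ring_partition_function_def
  proof (rule sum.cong[OF refl])
    fix x
    assume "x \<in> verts G \<rightarrow>\<^sub>E carrier R"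
    then have x: "x \<in> verts G \<rightarrow> carrier R"
      by auto
    have \<delta>: "coboundary R G x e = x (head G e) \<ominus> x (tail G e)" if "e \<in> arcs G" for e
      using R.coboundary_eq_head_minus_tail[OF fin_digraph_axioms that x] .
    have xs: "x (head G e) \<in> carrier R" "x (tail G e) \<in> carrier R" if "e \<in> arcs G" for e
      using x that by auto
    have "(\<Prod>a\<in>carrier R. s a ^ card {v \<in> verts G. x v = a}) = (\<Prod>v\<in>verts G. s (x v))"
      using x fin by (intro prod_power_card_fibre) auto
    moreover have "(\<Prod>b\<in>carrier R. t b ^ card {e \<in> arcs G. coboundary R G x e = b}) =
        (\<Prod>e\<in>arcs G. t (coboundary R G x e))"
      using xs fin by (intro prod_power_card_fibre) (auto simp: \<delta>)
    ultimately show "(\<Prod>v\<in>verts G. s (x v)) *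
        (\<Prod>e\<in>arcs G. \<Sum>d\<in>carrier R. u (d \<ominus> x (tail G e)) * u (d \<ominus> x (head G e))) =
        (\<Prod>a\<in>carrier R. s a ^ card {v \<in> verts G. x v = a}) *
        (\<Prod>b\<in>carrier R. t b ^ card {e \<in> arcs G. coboundary R G x e = b})"
      by (simp add: \<delta> edge xs)
  qed
  finally show ?thesis ..
qed

text \<open>Since \<open>w - 1 = q / (t - 1)\<close>, the sum is q + 2q/(t-1), plus (q/(t-1))^2 on
  the diagonal. Scaling by (t-1)^2/q turns the first part into (t-1)^2 + 2(t-1) = t^2 - 1 and the
  diagonal excess into q.\<close>

lemma sum_potts_half_edge_weights:
  fixes t :: "'k::field"
  assumes "h < q" "k < q" and q: "of_nat q \<noteq> (0::'k)" and t: "t - 1 \<noteq> 0" "t ^ 2 - 1 \<noteq> 0"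
    and w: "w = (t - 1 + of_nat q) / (t - 1)"
  shows "inverse (of_nat q) * (t - 1) ^ 2 *
      (\<Sum>d = 0..<q. (if d = h then w else 1) * (if d = k then w else 1)) =
    (t ^ 2 - 1) * (if h = k then (t ^ 2 - 1 + of_nat q) / (t ^ 2 - 1) else 1)"
proof -
  \<comment> \<open>Each weight is 1 plus \<open>w - 1\<close> at a single colour; the product of
    the two corrections survives only when \<open>d = h = k\<close>.\<close>
  have "(\<Sum>d = 0..<q. (if d = h then w else 1) * (if d = k then w else 1)) =
      (\<Sum>d = 0..<q. 1 + (if d = h then w - 1 else 0) + (if d = k then w - 1 else 0) +
        (if d = h then if h = k then (w - 1) ^ 2 else 0 else 0))"
    by (rule sum.cong) (auto simp: power2_eq_square algebra_simps)
  also have "\<dots> = of_nat q + 2 * (w - 1) + (if h = k then (w - 1) ^ 2 else 0)"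
    using assms(1,2) by (simp add: sum.distrib)
  also have "w - 1 = of_nat q / (t - 1)"
    using t by (simp add: w field_simps)
  finally have "(\<Sum>d = 0..<q. (if d = h then w else 1) * (if d = k then w else 1)) =
    of_nat q + 2 * (of_nat q / (t - 1)) + (if h = k then (of_nat q / (t - 1)) ^ 2 else 0)" .
  moreover have "inverse (of_nat q) * (t - 1) ^ 2 * (of_nat q + 2 * (of_nat q / (t - 1))) = t ^ 2 - 1"
    using q t(1) by (simp add: field_simps) (simp add: power2_eq_square algebra_simps)
  moreover have "inverse (of_nat q) * (t - 1) ^ 2 * (of_nat q / (t - 1)) ^ 2 = of_nat q"
    using q t(1) by (simp add: power_divide power2_eq_square)
  ultimately have "inverse (of_nat q) * (t - 1) ^ 2 *
      (\<Sum>d = 0..<q. (if d = h then w else 1) * (if d = k then w else 1)) =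
      t ^ 2 - 1 + (if h = k then of_nat q else 0)"
    \<comment> \<open>The instantiation splits off only the conditional summand, so that the other
      two remain together as in the preceding equation.\<close>
    by (simp only: distrib_left[of _ _ "if _ then _ else _"]) simp
  with t(2) show ?thesis
    by simp
qed

lemma (in fin_digraph) potts_partition_function_eq:
  fixes s :: "nat \<Rightarrow> 'k::field"
  assumes q: "of_nat q \<noteq> (0::'k)" and t: "t - 1 \<noteq> 0" "t ^ 2 - 1 \<noteq> 0"
  shows "(t ^ 2 - 1) ^ card (arcs G) *
      potts_partition_function q G s ((t ^ 2 - 1 + of_nat q) / (t ^ 2 - 1)) =
    of_nat q powi (- int (card (arcs G))) * (t - 1) ^ (2 * card (arcs G)) *
      (\<Sum>y \<in> arcs G \<rightarrow>\<^sub>E {0..<q}. \<Prod>v\<in>verts G. \<Sum>a = 0..<q.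
        s a * ((t - 1 + of_nat q) / (t - 1)) ^ half_edge_count G y v a)"
proof -
  define T where "T = (t ^ 2 - 1 + of_nat q) / (t ^ 2 - 1)"
  define w where "w = (t - 1 + of_nat q) / (t - 1)"
  \<comment> \<open>The share of a single arc in the prefactor of the edge-colouring sum.\<close>
  define z where "z = inverse (of_nat q) * (t - 1) ^ 2"
  let ?w = "\<lambda>a d. if d = a then w else 1"
  \<comment> \<open>Edge colours other than \<open>a\<close> get weight 1, which brings the power
    into the product form that \<open>half_edge_expansion\<close> expects.\<close>
  have weight: "w ^ half_edge_count G y v a = (\<Prod>d = 0..<q. ?w a d ^ half_edge_count G y v d)"
    if "a < q" for y v a
  proof -
    have "(\<Prod>d = 0..<q. ?w a d ^ half_edge_count G y v d) =
        (\<Prod>d = 0..<q. if d = a then w ^ half_edge_count G y v d else 1)"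
      by (rule prod.cong) auto
    with that show ?thesis
      by simp
  qed
  have "(\<Sum>y \<in> arcs G \<rightarrow>\<^sub>E {0..<q}. \<Prod>v\<in>verts G. \<Sum>a = 0..<q.
        s a * w ^ half_edge_count G y v a) =
      (\<Sum>y \<in> arcs G \<rightarrow>\<^sub>E {0..<q}. \<Prod>v\<in>verts G. \<Sum>a = 0..<q.
        s a * (\<Prod>d = 0..<q. ?w a d ^ half_edge_count G y v d))"
    by (simp add: weight)
  also have "\<dots> = (\<Sum>x \<in> verts G \<rightarrow>\<^sub>E {0..<q}. (\<Prod>v\<in>verts G. s (x v)) *
      (\<Prod>e\<in>arcs G. \<Sum>d = 0..<q. ?w (x (tail G e)) d * ?w (x (head G e)) d))"
    by (rule half_edge_expansion) auto
  finally have "z ^ card (arcs G) * (\<Sum>y \<in> arcs G \<rightarrow>\<^sub>E {0..<q}. \<Prod>v\<in>verts G. \<Sum>a = 0..<q.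
        s a * w ^ half_edge_count G y v a) =
      (\<Sum>x \<in> verts G \<rightarrow>\<^sub>E {0..<q}. (\<Prod>v\<in>verts G. s (x v)) *
        (\<Prod>e\<in>arcs G. z * (\<Sum>d = 0..<q. ?w (x (tail G e)) d * ?w (x (head G e)) d)))"
    by (simp only: prod.distrib prod_constant) (simp only: sum_distrib_left mult.left_commute)
  also have "\<dots> = (\<Sum>x \<in> verts G \<rightarrow>\<^sub>E {0..<q}. (t ^ 2 - 1) ^ card (arcs G) *
      (T ^ card {e \<in> arcs G. x (tail G e) = x (head G e)} *
        (\<Prod>a = 0..<q. s a ^ card {v \<in> verts G. x v = a})))"
  proof (rule sum.cong[OF refl])
    fix x
    assume x: "x \<in> verts G \<rightarrow>\<^sub>E {0..<q}"
    have "x (tail G e) < q" "x (head G e) < q" if "e \<in> arcs G" for e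
      using PiE_mem[OF x] that by fastforce+
    then have "(\<Prod>e\<in>arcs G. z * (\<Sum>d = 0..<q. ?w (x (tail G e)) d * ?w (x (head G e)) d)) =
        (\<Prod>e\<in>arcs G. (t ^ 2 - 1) * (if x (tail G e) = x (head G e) then T else 1))"
      unfolding z_def T_def
      by (intro prod.cong refl sum_potts_half_edge_weights q t w_def)
    also have "\<dots> = (t ^ 2 - 1) ^ card (arcs G) *
        T ^ card {e \<in> arcs G. x (tail G e) = x (head G e)}"
      by (simp add: prod.distrib prod.If_cases Int_def)
    finally show "(\<Prod>v\<in>verts G. s (x v)) *
        (\<Prod>e\<in>arcs G. z * (\<Sum>d = 0..<q. ?w (x (tail G e)) d * ?w (x (head G e)) d)) =
        (t ^ 2 - 1) ^ card (arcs G) * (T ^ card {e \<in> arcs G. x (tail G e) = x (head G e)} *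
          (\<Prod>a = 0..<q. s a ^ card {v \<in> verts G. x v = a}))"
      using x by (subst prod_power_card_fibre) (auto simp: ac_simps)
  qed
  also have "\<dots> = (t ^ 2 - 1) ^ card (arcs G) * potts_partition_function q G s T"
    by (simp only: potts_partition_function_def sum_distrib_left)
  finally show ?thesis
    by (simp add: T_def w_def z_def power_mult_distrib power_mult power_int_minus power_inverse)
qed

text \<open>The field of rational functions has characteristic zero, so dividing by q is legitimate
  there.\<close>

lemma of_nat_fract_poly_poly_nonzero: "q \<noteq> 0 \<Longrightarrow> of_nat q \<noteq> (0 :: complex poly poly fract)"
  by (simp add: of_nat_fract Zero_fract_def eq_fract)

lemma indet_t_nonzero: "indet_t - 1 \<noteq> 0" "indet_t ^ 2 - 1 \<noteq> 0"
  by (simp_all add: indet_t_def One_fract_def Zero_fract_def eq_fract power2_eq_square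
      one_pCons)

theorem theorem3p10:
  fixes Q :: "('r, 'm) ring_scheme" and G :: "('v, 'e) pre_digraph"
  assumes "fin_digraph G"
  shows
    "(cring Q \<and> finite (carrier Q) \<and> (\<exists>\<chi>. generating_character Q \<chi>) \<longrightarrow>
       (\<forall>s t u :: 'r \<Rightarrow> complex.
          (\<forall>b\<in>carrier Q. t (\<ominus>\<^bsub>Q\<^esub> b) = t b) \<longrightarrow>
          (\<forall>b\<in>carrier Q. t b = (\<Sum>a\<in>carrier Q. u a * u (a \<ominus>\<^bsub>Q\<^esub> b))) \<longrightarrow>
          ring_partition_function Q G s t =
            (\<Sum>y \<in> arcs G \<rightarrow>\<^sub>E carrier Q. \<Prod>v\<in>verts G. \<Sum>a\<in>carrier Q.
               s a * (\<Prod>b\<in>carrier Q. u b ^ half_edge_count G y v (a \<oplus>\<^bsub>Q\<^esub> b)))))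
     \<and>
     (\<forall>q::nat. q \<ge> 2 \<longrightarrow>
       (indet_t ^ 2 - 1) ^ card (arcs G) *
         potts_partition_function q G (\<lambda>a. indet_s ^ a)
           ((indet_t ^ 2 - 1 + of_nat q) / (indet_t ^ 2 - 1)) =
       of_nat q powi (- int (card (arcs G))) * (indet_t - 1) ^ (2 * card (arcs G)) *
         (\<Sum>y \<in> arcs G \<rightarrow>\<^sub>E {0..<q}. \<Prod>v\<in>verts G. \<Sum>a = 0..<q.
            indet_s ^ a *
            ((indet_t - 1 + of_nat q) / (indet_t - 1)) ^ half_edge_count G y v a))"
proof -
  interpret fin_digraph G by fact
  show ?thesis
  proof (intro conjI impI allI)
    fix s t u :: "'r \<Rightarrow> complex"
    assume "cring Q \<and> finite (carrier Q) \<and> (\<exists>\<chi>. generating_character Q \<chi>)"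
      and "\<forall>b\<in>carrier Q. t b = (\<Sum>a\<in>carrier Q. u a * u (a \<ominus>\<^bsub>Q\<^esub> b))"
    then show "ring_partition_function Q G s t =
        (\<Sum>y \<in> arcs G \<rightarrow>\<^sub>E carrier Q. \<Prod>v\<in>verts G. \<Sum>a\<in>carrier Q.
          s a * (\<Prod>b\<in>carrier Q. u b ^ half_edge_count G y v (a \<oplus>\<^bsub>Q\<^esub> b)))"
      by (intro ring_partition_function_eq[OF assms]) auto
  next
    fix q :: nat
    assume "q \<ge> 2"
    then show "(indet_t ^ 2 - 1) ^ card (arcs G) *
        potts_partition_function q G (\<lambda>a. indet_s ^ a)
          ((indet_t ^ 2 - 1 + of_nat q) / (indet_t ^ 2 - 1)) =
      of_nat q powi (- int (card (arcs G))) * (indet_t - 1) ^ (2 * card (arcs G)) *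
        (\<Sum>y \<in> arcs G \<rightarrow>\<^sub>E {0..<q}. \<Prod>v\<in>verts G. \<Sum>a = 0..<q.
          indet_s ^ a *
          ((indet_t - 1 + of_nat q) / (indet_t - 1)) ^ half_edge_count G y v a)"
      by (intro potts_partition_function_eq of_nat_fract_poly_poly_nonzero indet_t_nonzero) simp
  qed
qed

end
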